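(* Let $N = 2m$ with $m \in \mathbb{N}$, $m \ge 3$. Let $G$ be any network on $N$ nodes constructed as follows: the nodes are split into two halves $A$ and $B$ of $N/2$ nodes each; (i) all pairs of nodes within $A$ are linked and all pairs within $B$ are linked; (ii) each node of $A$ is linked to exactly two nodes of $B$ and each node of $B$ is linked to exactly two nodes of $A$, in such a way that for every integer $n$ with $1 \le n < N/2$, there do not exist a set $S$ of $n$ nodes in one half and a set $T$ of $n$ nodes in the other half such that every neighbour in the other half of every node of $S$ lies in $T$; there are no other links. Then $G$ is $N/2$-robust and has the minimum number of links among all $N/2$-robust networks on $N$ nodes.
   Context: A network is a finite simple undirected graph; links are edges. For an integer $N_f$, a network $G$ is $N_f$-robust if for every set $S$ of $N_f$ nodes of $G$, the network obtained by deleting the nodes of $S$ and their incident links is connected. *)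

theory Defs
  imports "Graph_Theory.Graph_Theory"
begin

text \<open>
  A network (finite simple undirected graph) is a \<^locale>\<open>pair_graph\<close>: every link
  \<open>{u, v}\<close> is represented by the two arcs \<open>(u, v)\<close> and \<open>(v, u)\<close>.
\<close>

definition links :: "'a pair_pre_digraph \<Rightarrow> 'a set set" where
  "links G = {{u, v} | u v. (u, v) \<in> parcs G}"

definition neighbours_in :: "'a pair_pre_digraph \<Rightarrow> 'a set \<Rightarrow> 'a \<Rightarrow> 'a set" where
  "neighbours_in G X u = {v \<in> X. (u, v) \<in> parcs G}"

definition robust :: "nat \<Rightarrow> 'a pair_pre_digraph \<Rightarrow> bool" where
  "robust k G \<longleftrightarrow>
    (\<forall>S. S \<subseteq> pverts G \<and> card S = k \<longrightarrow> connected (with_proj G \<restriction> (pverts G - S)))"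

end

theory Submission
  imports Defs
begin

text \<open>
  In an \<open>m\<close>-robust network on \<open>2m\<close> nodes every degree is at least \<open>m + 1\<close>, since otherwise some
  \<open>m\<close> nodes could be deleted so as to isolate a node; so there are at least \<open>m(m + 1)\<close> links.
  In \<open>G\<close> every degree is exactly \<open>(m - 1) + 2\<close>. After deleting \<open>m\<close> nodes of \<open>G\<close>, the two halves
  remain cliques; if both are nonempty and \<open>n\<close> nodes of \<open>A\<close> survive, then exactly \<open>n\<close> nodes of
  \<open>B\<close> were deleted, and these cannot contain all neighbours in \<open>B\<close> of the survivors.
\<close>

text \<open>Arcs are grouped by their tail. Combined with the count of arcs per link below, this
  gives the handshake lemma.\<close>

lemma (in pair_fin_digraph) card_parcs_eq_sum_neighbours:
  "card (parcs G) = (\<Sum>u\<in>pverts G. card (neighbours_in G (pverts G) u))"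
proof -
  have "parcs G = (SIGMA u:pverts G. neighbours_in G (pverts G) u)"
    by (auto simp: neighbours_in_def dest: in_arcsD1 in_arcsD2)
  moreover have "finite (neighbours_in G (pverts G) u)" for u
    using pair_finite_verts by (simp add: neighbours_in_def)
  ultimately show ?thesis
    using pair_finite_verts by simp
qed

text \<open>Forgetting orientation maps arcs onto links. Each fibre is
  \<open>{(u, v), (v, u)}\<close>: both arcs are present by symmetry, and they differ because there
  are no loops.\<close>

lemma (in pair_graph) card_parcs_eq_double_links: "card (parcs G) = 2 * card (links G)"
proof -
  define ends where "ends = (\<lambda>(u :: 'a, v). {u, v})"
  have links: "links G = ends ` parcs G"
    by (auto simp: links_def ends_def image_iff)
  have fibre: "card {e \<in> parcs G. ends e = l} = 2" if l: "l \<in> links G" for l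
  proof -
    obtain u v where uv: "(u, v) \<in> parcs G" "l = {u, v}"
      using l by (auto simp: links_def)
    have "u \<noteq> v" using uv(1) pair_no_loops by fastforce
    moreover have "{e \<in> parcs G. ends e = l} = {(u, v), (v, u)}"
      using uv arcs_symmetric by (auto simp: ends_def doubleton_eq_iff)
    ultimately show ?thesis by simp
  qed
  have "card (parcs G) = (\<Sum>l\<in>ends ` parcs G. \<Sum>e | e \<in> parcs G \<and> ends e = l. 1)"
    using sum.image_gen[OF pair_finite_arcs, of "\<lambda>_. 1::nat" ends] by simp
  also have "\<dots> = (\<Sum>l\<in>links G. 2)"
    unfolding links using fibre links by (intro sum.cong) auto
  finally show ?thesis by simp
qed

text \<open>The bound \<open>k + 1 < card (pverts G)\<close> leaves room for a \<open>k\<close>-set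
  that contains all neighbours of \<open>v\<close> but not \<open>v\<close>, and ensures that a
  second node \<open>w\<close> survives its deletion, so that isolating \<open>v\<close> really
  disconnects the network.\<close>

lemma (in pair_graph) robust_imp_less_degree:
  assumes "robust k G" and "v \<in> pverts G" and "k + 1 < card (pverts G)"
  shows "k < card (neighbours_in G (pverts G) v)"
proof (rule ccontr)
  let ?N = "neighbours_in G (pverts G) v"
  assume "\<not> k < card ?N"
  moreover have "?N \<subseteq> pverts G - {v}"
    using pair_no_loops by (fastforce simp: neighbours_in_def)
  moreover have "k \<le> card (pverts G - {v})"
    using assms(2,3) by simp
  ultimately obtain S where S: "?N \<subseteq> S" "S \<subseteq> pverts G - {v}" "card S = k"
    using exists_subset_between[of ?N k "pverts G - {v}"] pair_finite_verts by auto
  let ?V = "pverts G - S"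
  have "finite S" using S(2) pair_finite_verts by (meson finite_Diff finite_subset)
  then have "card ?V = card (pverts G) - k"
    using S by (metis card_Diff_subset subset_trans Diff_subset)
  then have "card (?V - {v}) > 0"
    using assms(2,3) S(2) by (subst card_Diff_singleton) auto
  then obtain w where w: "w \<in> ?V" "w \<noteq> v"
    by (metis card_gt_0_iff ex_in_conv Diff_iff singletonI)
  have "connected (with_proj G \<restriction> ?V)"
    using assms(1) S unfolding robust_def by blast
  moreover have "v \<in> ?V" using assms(2) S(2) by blast
  ultimately have "(v, w) \<in> rtrancl_on ?V ((arcs_ends (with_proj G \<restriction> ?V))\<^sup>s)"
    using w(1) unfolding connected_conv by simp
  \<comment> \<open>Only the first step of the walk from \<open>v\<close> to \<open>w\<close>
    matters: its end \<open>x\<close> is a surviving neighbour of \<open>v\<close>, yet all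
    neighbours of \<open>v\<close> lie in \<open>S\<close>.\<close>
  then obtain x where "(v, x) \<in> (arcs_ends (with_proj G \<restriction> ?V))\<^sup>s"
    using w(2) by (cases rule: converse_rtrancl_on_cases) auto
  then have "(v, x) \<in> parcs G" "x \<in> ?V"
    by (auto simp: arcs_ends_conv symcl_def intro: arcs_symmetric)
  then show False
    using S(1) by (auto simp: neighbours_in_def)
qed

text \<open>Nodes in different cliques are joined through one crossing arc. The condition
  \<open>cross\<close> is conditional because a deletion may wipe out a whole half, leaving a single
  clique.\<close>

lemma (in pair_graph) connected_two_cliques:
  assumes "V = C \<union> D" and "V \<noteq> {}"
    and C: "\<And>u v. u \<in> C \<Longrightarrow> v \<in> C \<Longrightarrow> u \<noteq> v \<Longrightarrow> (u, v) \<in> parcs G"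
    and D: "\<And>u v. u \<in> D \<Longrightarrow> v \<in> D \<Longrightarrow> u \<noteq> v \<Longrightarrow> (u, v) \<in> parcs G"
    and cross: "C \<noteq> {} \<Longrightarrow> D \<noteq> {} \<Longrightarrow> \<exists>c\<in>C. \<exists>d\<in>D. (c, d) \<in> parcs G"
  shows "connected (with_proj G \<restriction> V)"
proof -
  let ?H = "with_proj G \<restriction> V"
  interpret V: wf_digraph ?H
    by (rule wellformed_induce_subgraph)
  \<comment> \<open>The case \<open>u = v\<close> covers paths whose endpoint is already an end of
    the crossing arc.\<close>
  have adj: "u \<rightarrow>\<^sup>*\<^bsub>?H\<^esub> v" if "u \<in> V" "v \<in> V" "u = v \<or> (u, v) \<in> parcs G" for u v
  proof (cases "u = v")
    case False
    then show ?thesis using that by (intro V.reachable_adjI) (auto simp: arcs_ends_conv)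
  qed (use that in simp)
  have reach: "u \<rightarrow>\<^sup>*\<^bsub>?H\<^esub> v" if uv: "u \<in> V" "v \<in> V" for u v
  proof -
    consider "u \<in> C" "v \<in> C" | "u \<in> D" "v \<in> D" | "u \<in> C" "v \<in> D" | "u \<in> D" "v \<in> C"
      using uv assms(1) by blast
    then show ?thesis
    proof cases
      case 1
      then show ?thesis using adj uv C by blast
    next
      case 2
      then show ?thesis using adj uv D by blast
    next
      case 3
      then obtain c d where "c \<in> C" "d \<in> D" "(c, d) \<in> parcs G" using cross by blast
      then have "u \<rightarrow>\<^sup>*\<^bsub>?H\<^esub> c" "c \<rightarrow>\<^sup>*\<^bsub>?H\<^esub> d" "d \<rightarrow>\<^sup>*\<^bsub>?H\<^esub> v"
        using 3 adj C D assms(1) by blast+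
      then show ?thesis by (blast intro: V.reachable_trans)
    next
      case 4
      then obtain c d where "c \<in> C" "d \<in> D" "(d, c) \<in> parcs G"
        using cross arcs_symmetric by blast
      then have "u \<rightarrow>\<^sup>*\<^bsub>?H\<^esub> d" "d \<rightarrow>\<^sup>*\<^bsub>?H\<^esub> c" "c \<rightarrow>\<^sup>*\<^bsub>?H\<^esub> v"
        using 4 adj C D assms(1) by blast+
      then show ?thesis by (blast intro: V.reachable_trans)
    qed
  qed
  show ?thesis
    unfolding connected_def
  proof (rule strongly_connectedI)
    show "verts (with_proj (mk_symmetric ?H)) \<noteq> {}" using assms(2) by simp
  qed (auto intro: V.reachable_mk_symmetricI reach)
qed

theorem theorem2:
  fixes N m :: nat
    and G :: "'a pair_pre_digraph"
    and A B :: "'a set"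
  assumes "N = 2 * m" and "m \<ge> 3"
    and "pair_graph G"
    and "pverts G = A \<union> B" and "A \<inter> B = {}"
    and "card A = N div 2" and "card B = N div 2"
    and "\<forall>u\<in>A. \<forall>v\<in>A. u \<noteq> v \<longrightarrow> (u, v) \<in> parcs G"
    and "\<forall>u\<in>B. \<forall>v\<in>B. u \<noteq> v \<longrightarrow> (u, v) \<in> parcs G"
    and "\<forall>a\<in>A. card (neighbours_in G B a) = 2"
    and "\<forall>b\<in>B. card (neighbours_in G A b) = 2"
    and "\<forall>n. 1 \<le> n \<and> n < N div 2 \<longrightarrow>
           \<not> (\<exists>S T. S \<subseteq> A \<and> T \<subseteq> B \<and> card S = n \<and> card T = n \<and>
                  (\<forall>u\<in>S. neighbours_in G B u \<subseteq> T))"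
    and "\<forall>n. 1 \<le> n \<and> n < N div 2 \<longrightarrow>
           \<not> (\<exists>S T. S \<subseteq> B \<and> T \<subseteq> A \<and> card S = n \<and> card T = n \<and>
                  (\<forall>u\<in>S. neighbours_in G A u \<subseteq> T))"
  shows "robust (N div 2) G \<and>
         (\<forall>H :: 'b pair_pre_digraph.
            pair_graph H \<and> card (pverts H) = N \<and> robust (N div 2) H \<longrightarrow>
            card (links G) \<le> card (links H))"
proof -
  interpret G: pair_graph G by fact
  have half: "N div 2 = m" using assms(1) by simp
  have cardA: "card A = m" and cardB: "card B = m" using assms(6,7) half by simp_all
  have fin: "finite A" "finite B" using G.pair_finite_verts assms(4) by simp_all
  have "robust m G"
    unfolding robust_def
  proof (intro allI impI, elim conjE)
    fix S assume S: "S \<subseteq> pverts G" "card S = m"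
    have "finite S" using S(1) G.pair_finite_verts finite_subset by blast
    have "card (pverts G) = 2 * m"
      using assms(4,5) cardA cardB fin by (simp add: card_Un_disjoint)
    then have "card (pverts G - S) = m"
      using S \<open>finite S\<close> by (simp add: card_Diff_subset)
    then have nonempty: "pverts G - S \<noteq> {}" using assms(2) by force
    have cross: "\<exists>a\<in>A - S. \<exists>b\<in>B - S. (a, b) \<in> parcs G" if ne: "A - S \<noteq> {}" "B - S \<noteq> {}"
    proof (rule ccontr)
      assume none: "\<not> ?thesis"
      let ?n = "card (A - S)"
      have "card S = card (A \<inter> S) + card (B \<inter> S)"
        using S(1) assms(4,5) fin
        by (subst card_Un_disjoint[symmetric]) (auto intro!: arg_cong[where f = card])
      moreover have "card A = ?n + card (A \<inter> S)"
        using fin by (metis add.commute card_Int_Diff)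
      moreover have "card B = card (B - S) + card (B \<inter> S)"
        using fin by (metis add.commute card_Int_Diff)
      moreover have "0 < ?n" "0 < card (B - S)"
        using ne fin by (simp_all add: card_gt_0_iff)
      \<comment> \<open>As \<open>S\<close> and \<open>A\<close> both have \<open>m\<close>
        elements, as many nodes are missing from \<open>B\<close> as survive in \<open>A\<close>; a
        survivor in \<open>B\<close> makes this number less than \<open>m\<close>. So
        \<open>A - S\<close> and \<open>B \<inter> S\<close> form a forbidden pair.\<close>
      ultimately have "1 \<le> ?n" "?n < N div 2" "card (B \<inter> S) = ?n"
        using S(2) cardA cardB half by simp_all
      moreover have "\<forall>u\<in>A - S. neighbours_in G B u \<subseteq> B \<inter> S"
        using none by (auto simp: neighbours_in_def)
      ultimately show False
        using assms(12) by (metis Diff_subset Int_lower1)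
    qed
    show "connected (with_proj G \<restriction> (pverts G - S))"
      using assms(4,8,9) nonempty cross
      by (intro G.connected_two_cliques[of _ "A - S" "B - S"]) auto
  qed
  moreover have "card (links G) \<le> card (links H)"
    if H: "pair_graph H" "card (pverts H) = N" "robust m H" for H :: "'b pair_pre_digraph"
  proof -
    interpret H: pair_graph H by fact
    have degG: "card (neighbours_in G (pverts G) u) = m + 1" if "u \<in> pverts G" for u
    proof -
      \<comment> \<open>With \<open>C\<close> the half containing \<open>u\<close> and
        \<open>D\<close> the other one, both halves are treated at once: \<open>m - 1\<close>
        neighbours in \<open>C\<close> and two in \<open>D\<close>.\<close>
      have deg: "card (neighbours_in G (pverts G) u) = m + 1"
        if "pverts G = C \<union> D" "C \<inter> D = {}" "card C = m" "finite C" "finite D" "u \<in> C"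
          "\<forall>v\<in>C. u \<noteq> v \<longrightarrow> (u, v) \<in> parcs G" "card (neighbours_in G D u) = 2" for C D
      proof -
        have "neighbours_in G (pverts G) u = (C - {u}) \<union> neighbours_in G D u"
          using that(1,6,7) G.pair_no_loops by (fastforce simp: neighbours_in_def)
        moreover have "(C - {u}) \<inter> neighbours_in G D u = {}"
          using that(2) by (auto simp: neighbours_in_def)
        moreover have "finite (neighbours_in G D u)"
          using that(5) by (simp add: neighbours_in_def)
        ultimately show ?thesis
          using that(3,4,6,8) assms(2) by (simp add: card_Un_disjoint)
      qed
      show ?thesis
      proof (cases "u \<in> A")
        case True
        then show ?thesis using assms(4,5,8,10) cardA fin by (intro deg[of A B]) auto
      next
        case False
        then show ?thesis
          using assms(4,5,9,11) cardB fin \<open>u \<in> pverts G\<close> by (intro deg[of B A]) auto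
      qed
    qed
    have cardG: "card (pverts G) = N"
      using assms(1,4,5) cardA cardB fin by (simp add: card_Un_disjoint)
    have "2 * card (links G) = (\<Sum>u\<in>pverts G. card (neighbours_in G (pverts G) u))"
      using G.card_parcs_eq_double_links G.card_parcs_eq_sum_neighbours by simp
    \<comment> \<open>The summand is constant and both networks have \<open>N\<close> nodes, so the
      sum can be moved to the nodes of \<open>H\<close>.\<close>
    also have "\<dots> = (\<Sum>v\<in>pverts H. m + 1)"
      using degG cardG H(2) by simp
    also have "\<dots> \<le> (\<Sum>v\<in>pverts H. card (neighbours_in H (pverts H) v))"
    proof (rule sum_mono)
      fix v assume "v \<in> pverts H"
      \<comment> \<open>The degree bound applies with \<open>k = m\<close> since
        \<open>m \<ge> 3\<close> gives \<open>m + 1 < 2 * m\<close>.\<close>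
      then show "m + 1 \<le> card (neighbours_in H (pverts H) v)"
        using H.robust_imp_less_degree[OF H(3)] H(2) assms(1,2) by (simp add: Suc_le_eq)
    qed
    also have "\<dots> = 2 * card (links H)"
      using H.card_parcs_eq_double_links H.card_parcs_eq_sum_neighbours by simp
    finally show ?thesis by simp
  qed
  ultimately show ?thesis
    unfolding half by blast
qed

end
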